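(* Let $\mathcal{A}$ be a unital $C^*$-algebra and let $\mathcal{F}\subseteq\mathcal{A}\cong B(\mathcal{A})$ be an ideal of finite type elements. Let $F\in B(\mathcal{A})$ and suppose that $\mathrm{Im}\,F$ is closed. Then a) $F\in\mathcal{M}\mathcal{K}\Phi_{+}(\mathcal{A})$ if and only if $P_{\ker F}\in\mathcal{F}$; b) $F\in\mathcal{M}\mathcal{K}\Phi_{-}(\mathcal{A})$ if and only if $P_{(\mathrm{Im}\,F)^{\perp}}\in\mathcal{F}$.
   Context: $\mathcal{A}$ is regarded as a right Hilbert module over itself and $B(\mathcal{A})$ is the $C^*$-algebra of all bounded $\mathcal{A}$-linear operators on $\mathcal{A}$ (all are adjointable). The map $a\mapsto L_a$ (left multiplication by $a$) is an isometric $*$-isomorphism $\mathcal{A}\to B(\mathcal{A})$, and $\mathcal{A}$ is identified with $B(\mathcal{A})$ through it; accordingly $\mathcal{F}$ is identified with its image in $B(\mathcal{A})$. Ideal of finite type elements: a subalgebra $\mathcal{F}\subseteq\mathcal{A}$ such that (i) $\mathcal{F}$ is a selfadjoint (two-sided) ideal in $\mathcal{A}$; (ii) there is an approximate unit $\{P_\alpha\}$ for $\mathcal{F}$, contained in $\mathcal{F}$, consisting of (orthogonal) projections; (iii) if $p,q\in\mathcal{F}$ are projections, then there exists $v\in\mathcal{A}$ such that $vv^*=q$ and $v^*v\perp p$, i.e. $v^*v+p$ is a projection as well. For closed submodules $M_1,M_2$ of a Hilbert module $M$, $M=M_1\tilde\oplus M_2$ means $M_1\cap M_2=\{0\}$ and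 $M_1+M_2=M$ (not necessarily orthogonal). A closed submodule is complementable if it is a summand in such a decomposition. Every closed complementable submodule $M$ of $\mathcal{A}$ is orthogonally complementable; $P_M$ denotes the orthogonal projection onto $M$. If $F\in B(\mathcal{A})$ has closed image, then $\ker F$ and $\mathrm{Im}\,F$ are orthogonally complementable in $\mathcal{A}$. $F\in\mathcal{M}\mathcal{K}\Phi_+(\mathcal{A})$ (resp. $F\in\mathcal{M}\mathcal{K}\Phi_-(\mathcal{A})$) means: there is a decomposition $\mathcal{A}=M_1\tilde\oplus N_1\stackrel{F}{\longrightarrow}M_2\tilde\oplus N_2=\mathcal{A}$ (closed submodules) with respect to which $F$ has the matrix $\begin{pmatrix}F_1&0\\0&F_4\end{pmatrix}$, where $F_1:M_1\to M_2$ is an isomorphism (bounded $\mathcal{A}$-linear bijection with bounded inverse) and $P_{N_1}\in\mathcal{F}$ (resp. $P_{N_2}\in\mathcal{F}$). *)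

theory Defs
  imports "HOL-Analysis.Analysis"
begin

class scaleC =
  fixes scaleC :: "complex \<Rightarrow> 'a \<Rightarrow> 'a"  (infixr "*\<^sub>C" 75)

class star =
  fixes star :: "'a \<Rightarrow> 'a"

text \<open>The class \<open>real_normed_algebra_1\<close> is avoided because it excludes the zero algebra;
  \<open>norm 1 = 1\<close> follows from the axioms below whenever \<open>1 \<noteq> 0\<close>.\<close>

class unital_cstar_algebra = real_normed_algebra + banach + monoid_mult + scaleC + star +
  assumes scaleC_add_right: "c *\<^sub>C (x + y) = c *\<^sub>C x + c *\<^sub>C y"
    and scaleC_add_left: "(c + d) *\<^sub>C x = c *\<^sub>C x + d *\<^sub>C x"
    and scaleC_scaleC: "c *\<^sub>C (d *\<^sub>C x) = (c * d) *\<^sub>C x"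
    and scaleC_of_real: "complex_of_real r *\<^sub>C x = r *\<^sub>R x"
    and mult_scaleC_left: "(c *\<^sub>C x) * y = c *\<^sub>C (x * y)"
    and mult_scaleC_right: "x * (c *\<^sub>C y) = c *\<^sub>C (x * y)"
    and norm_scaleC: "norm (c *\<^sub>C x) = cmod c * norm x"
    and star_star: "star (star x) = x"
    and star_add: "star (x + y) = star x + star y"
    and star_mult: "star (x * y) = star y * star x"
    and star_scaleC: "star (c *\<^sub>C x) = cnj c *\<^sub>C star x"
    and cstar_identity: "norm (star x * x) = (norm x)\<^sup>2"

definition projection :: "'a::unital_cstar_algebra \<Rightarrow> bool" where
  "projection p \<longleftrightarrow> star p = p \<and> p * p = p"

definition star_subalgebra :: "'a::unital_cstar_algebra set \<Rightarrow> bool" where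
  "star_subalgebra S \<longleftrightarrow> 0 \<in> S \<and> (\<forall>x\<in>S. \<forall>y\<in>S. x + y \<in> S) \<and> (\<forall>c. \<forall>x\<in>S. c *\<^sub>C x \<in> S)
    \<and> (\<forall>x\<in>S. \<forall>y\<in>S. x * y \<in> S) \<and> (\<forall>x\<in>S. star x \<in> S)"

text \<open>Nets in \<open>S\<close> are rendered as proper filters containing \<open>S\<close>: a net \<open>P\<close> gives the filter
  generated by its tails, and every proper filter arises in this way. No monotonicity is required.\<close>

definition has_projection_approximate_unit :: "'a::unital_cstar_algebra set \<Rightarrow> bool" where
  "has_projection_approximate_unit S \<longleftrightarrow>
    (\<exists>U. U \<noteq> bot \<and> (\<forall>\<^sub>F p in U. p \<in> S \<and> projection p)
      \<and> (\<forall>f\<in>S. ((\<lambda>p. p * f) \<longlongrightarrow> f) U \<and> ((\<lambda>p. f * p) \<longlongrightarrow> f) U))"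

text \<open>Neither closedness nor properness of the ideal is required.\<close>

definition finite_type_ideal :: "'a::unital_cstar_algebra set \<Rightarrow> bool" where
  "finite_type_ideal S \<longleftrightarrow> star_subalgebra S
    \<and> (\<forall>a. \<forall>f\<in>S. a * f \<in> S \<and> f * a \<in> S)
    \<and> has_projection_approximate_unit S
    \<and> (\<forall>p\<in>S. \<forall>q\<in>S. projection p \<longrightarrow> projection q \<longrightarrow>
          (\<exists>v. v * star v = q \<and> projection (star v * v + p)))"

text \<open>The algebra is a right Hilbert module over itself with inner product
  \<open>\<langle>x, y\<rangle> = star x * y\<close>. Since it is unital, closure under right multiplication
  (resp. commutation with it) already covers the complex scalars \<open>x * (c *\<^sub>C 1)\<close>.\<close>

definition closed_submodule :: "'a::unital_cstar_algebra set \<Rightarrow> bool" where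
  "closed_submodule M \<longleftrightarrow> closed M \<and> 0 \<in> M \<and> (\<forall>x\<in>M. \<forall>y\<in>M. x + y \<in> M)
    \<and> (\<forall>x\<in>M. \<forall>a. x * a \<in> M)"

definition module_operators :: "('a::unital_cstar_algebra \<Rightarrow> 'a) set" where
  "module_operators = {T. bounded_linear T \<and> (\<forall>x a. T (x * a) = T x * a)}"

definition left_mult :: "'a::unital_cstar_algebra \<Rightarrow> 'a \<Rightarrow> 'a" where
  "left_mult a = (\<lambda>x. a * x)"

definition orth_compl :: "'a::unital_cstar_algebra set \<Rightarrow> 'a set" where
  "orth_compl M = {x. \<forall>m\<in>M. star m * x = 0}"

text \<open>Meaningful only when \<open>M\<close> is orthogonally complementable.\<close>

definition orth_proj :: "'a::unital_cstar_algebra set \<Rightarrow> 'a \<Rightarrow> 'a" where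
  "orth_proj M x = (THE y. y \<in> M \<and> x - y \<in> orth_compl M)"

definition direct_decomposition :: "'a::unital_cstar_algebra set \<Rightarrow> 'a set \<Rightarrow> bool" where
  "direct_decomposition M N \<longleftrightarrow> closed_submodule M \<and> closed_submodule N
    \<and> M \<inter> N = {0} \<and> {x + y | x y. x \<in> M \<and> y \<in> N} = UNIV"

text \<open>Boundedness and linearity of the restriction itself are inherited from \<open>T\<close>.\<close>

definition restricts_to_iso ::
  "('a::unital_cstar_algebra \<Rightarrow> 'a) \<Rightarrow> 'a set \<Rightarrow> 'a set \<Rightarrow> bool" where
  "restricts_to_iso T M M' \<longleftrightarrow> T \<in> module_operators \<and> bij_betw T M M'
    \<and> (\<exists>C. \<forall>y\<in>M'. norm (inv_into M T y) \<le> C * norm y)"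

text \<open>The off-diagonal entries of the matrix of \<open>T\<close> vanish iff \<open>T\<close> maps
  \<open>M1\<close> into \<open>M2\<close> and \<open>N1\<close> into \<open>N2\<close>.\<close>

definition diagonalizing_decomposition ::
  "('a::unital_cstar_algebra \<Rightarrow> 'a) \<Rightarrow> 'a set \<Rightarrow> 'a set \<Rightarrow> 'a set \<Rightarrow> 'a set \<Rightarrow> bool" where
  "diagonalizing_decomposition T M1 N1 M2 N2 \<longleftrightarrow>
    direct_decomposition M1 N1 \<and> direct_decomposition M2 N2
    \<and> T ` M1 \<subseteq> M2 \<and> T ` N1 \<subseteq> N2 \<and> restricts_to_iso T M1 M2"

definition MKPhi_plus :: "'a::unital_cstar_algebra set \<Rightarrow> ('a \<Rightarrow> 'a) set" where
  "MKPhi_plus S = {T \<in> module_operators. \<exists>M1 N1 M2 N2.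
    diagonalizing_decomposition T M1 N1 M2 N2 \<and> orth_proj N1 \<in> left_mult ` S}"

definition MKPhi_minus :: "'a::unital_cstar_algebra set \<Rightarrow> ('a \<Rightarrow> 'a) set" where
  "MKPhi_minus S = {T \<in> module_operators. \<exists>M1 N1 M2 N2.
    diagonalizing_decomposition T M1 N1 M2 N2 \<and> orth_proj N2 \<in> left_mult ` S}"

end

theory Submission
  imports Defs
begin

text \<open>
  A module operator \<open>F\<close> is left multiplication by \<open>a = F 1\<close>, so everything is a statement about
  the right ideal \<open>aA\<close>, the annihilator \<open>{x. ax = 0}\<close> and idempotents.

  The one analytic input is that a closed \<open>aA\<close> makes \<open>a\<close> von Neumann regular:
  \<open>a = aba\<close> for some \<open>b\<close> (\<open>regular_of_closed_range\<close>).  By a Baire category argument,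
  \<open>a\<^sup>*\<close> is bounded below on the Banach space \<open>aA\<close>, hence so is the selfadjoint
  \<open>h = aa\<^sup>*\<close>.  As \<open>\<epsilon> + ih\<close> is invertible for \<open>\<epsilon> > 0\<close>, one can let \<open>\<epsilon>\<close> tend to 0 and solve
  \<open>hc = a\<close>; then \<open>a = aa\<^sup>*c = ac\<^sup>*a\<close>.

  Regularity exhibits \<open>Im F\<close> as \<open>(ab)A\<close> and \<open>ker F\<close> as \<open>(1 - ba)A\<close>, with both elements
  idempotent.  Every idempotent generates the same right ideal as some projection
  (\<open>projection_of_idempotent\<close>), so both submodules are orthogonally complementable; and the summands
  of an arbitrary direct decomposition are likewise generated by idempotents, namely by the
  components of 1 (\<open>direct_decomposition_idempotent\<close>).

  If \<open>P\<close> is the projection onto \<open>ker F\<close> and \<open>Q\<close> the one onto \<open>Im F\<close>, the decomposition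
  \<open>(1-P)A \<oplus> PA \<rightarrow> QA \<oplus> (1-Q)A\<close> diagonalizes \<open>F\<close>, which gives the two implications from right to
  left.  Conversely, in a diagonalizing decomposition \<open>ker F \<subseteq> N\<^sub>1\<close>, so
  \<open>P = P\<^bsub>N\<^sub>1\<^esub> P\<close>; and \<open>M\<^sub>2 \<subseteq> Im F\<close>, so \<open>(1 - Q)(1 - f) = 0\<close>
  for the idempotent \<open>f\<close> onto \<open>N\<^sub>2\<close> along \<open>M\<^sub>2\<close>, whence
  \<open>1 - Q = (1 - Q)f = (1 - Q) P\<^bsub>N\<^sub>2\<^esub> f\<close>.  Both products lie in the ideal.
\<close>

section \<open>The involution\<close>

lemma star_zero: "star (0::'a::unital_cstar_algebra) = 0"
  using star_add[of 0 "0::'a"] by simp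

lemma star_minus: "star (- x) = - star (x::'a::unital_cstar_algebra)"
  using star_add[of x "- x"] by (simp add: star_zero eq_neg_iff_add_eq_0 add.commute)

lemma star_diff: "star (x - y) = star x - star (y::'a::unital_cstar_algebra)"
  using star_add[of x "- y"] by (simp add: star_minus)

lemma star_one: "star (1::'a::unital_cstar_algebra) = 1"
  by (metis mult_1_left mult_1_right star_mult star_star)

lemma star_scaleR: "star (r *\<^sub>R x) = r *\<^sub>R star (x::'a::unital_cstar_algebra)"
  by (metis complex_cnj_complex_of_real scaleC_of_real star_scaleC)

lemma norm_star: "norm (star x) = norm (x::'a::unital_cstar_algebra)"
proof -
  have le: "norm y \<le> norm (star y)" for y :: 'a
  proof (cases "norm y = 0")
    case False
    have "norm y * norm y \<le> norm (star y) * norm y"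
      using norm_mult_ineq[of "star y" y] by (simp add: cstar_identity power2_eq_square)
    then show ?thesis using False by simp
  qed simp
  show ?thesis using le[of x] le[of "star x"] by (simp add: star_star)
qed

lemma norm_one_le: "norm (1::'a::unital_cstar_algebra) \<le> 1"
proof -
  have "norm (1::'a) = (norm (1::'a))\<^sup>2"
    using cstar_identity[of "1::'a"] by (simp add: star_one)
  then show ?thesis by (cases "norm (1::'a) = 0") (auto simp: power2_eq_square)
qed

section \<open>Invertibility\<close>

text \<open>The Neumann series, summed as the fixed point of a contraction.\<close>

lemma right_inverse_one_minus:
  fixes x :: "'a::unital_cstar_algebra"
  assumes "norm x < 1"
  shows "\<exists>r. (1 - x) * r = 1"
proof -
  have "\<exists>!y. 1 + x * y = y"
  proof (rule banach_fix_type[of "norm x"])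
    show "\<forall>y z. dist (1 + x * y) (1 + x * z) \<le> norm x * dist y z"
      by (auto simp: dist_norm norm_mult_ineq simp flip: right_diff_distrib)
  qed (use assms in auto)
  then obtain y where "1 + x * y = y" by blast
  then have "(1 - x) * y = 1" by (simp add: left_diff_distrib diff_eq_eq)
  then show ?thesis ..
qed

text \<open>The spectrum of a skew-adjoint element is imaginary.  By the C*-identity,
  \<open>\<parallel>z - t\<parallel>\<^sup>2 \<le> \<parallel>z\<parallel>\<^sup>2 + t\<^sup>2\<close>, which is smaller than \<open>(\<epsilon> + t)\<^sup>2\<close> for
  large \<open>t\<close>; so \<open>\<epsilon> + z = (\<epsilon> + t) - (t - z)\<close> is inverted by a Neumann series.\<close>

lemma right_inverse_skew:
  fixes z :: "'a::unital_cstar_algebra"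
  assumes skew: "star z = - z" and eps: "\<epsilon> > 0"
  shows "\<exists>r. (\<epsilon> *\<^sub>R 1 + z) * r = 1"
proof -
  \<comment> \<open>Chosen so that \<open>2\<epsilon>t = \<parallel>z\<parallel>\<^sup>2\<close>, leaving \<open>\<epsilon>\<^sup>2\<close> to spare.\<close>
  define t where "t = (norm z)\<^sup>2 / (2 * \<epsilon>)"
  define \<mu> where "\<mu> = \<epsilon> + t"
  have t0: "t \<ge> 0" and l0: "\<mu> > 0" using eps by (auto simp: t_def \<mu>_def add_pos_nonneg)
  have "(norm (z - t *\<^sub>R 1))\<^sup>2 = norm (star (z - t *\<^sub>R 1) * (z - t *\<^sub>R 1))"
    by (simp add: cstar_identity)
  also have "star (z - t *\<^sub>R 1) * (z - t *\<^sub>R 1) = (t * t) *\<^sub>R 1 - z * z"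
    by (simp add: star_diff star_scaleR star_one skew algebra_simps)
  also have "norm ((t * t) *\<^sub>R 1 - z * z) \<le> norm ((t * t) *\<^sub>R (1::'a)) + norm (z * z)"
    by (rule norm_triangle_ineq4)
  also have "\<dots> \<le> t * t + norm z * norm z"
    using norm_mult_ineq[of z z] norm_one_le[where 'a='a]
    by (intro add_mono) (auto simp: abs_mult mult_left_le)
  also have "\<dots> < \<mu>\<^sup>2"
    using eps by (simp add: \<mu>_def t_def power2_eq_square field_simps)
  finally have "norm (z - t *\<^sub>R 1) < \<mu>"
    using l0 by (simp add: power_less_imp_less_base)
  then have "norm ((1 / \<mu>) *\<^sub>R (t *\<^sub>R 1 - z)) < 1"
    using l0 by (simp add: norm_minus_commute)
  then obtain r where r: "(1 - (1 / \<mu>) *\<^sub>R (t *\<^sub>R 1 - z)) * r = 1"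
    using right_inverse_one_minus by blast
  have "\<mu> *\<^sub>R (1 - (1 / \<mu>) *\<^sub>R (t *\<^sub>R 1 - z)) = \<epsilon> *\<^sub>R 1 + z"
    using l0 by (simp add: scaleR_diff_right \<mu>_def scaleR_add_left)
  then have "\<epsilon> *\<^sub>R 1 + z = \<mu> *\<^sub>R (1 - (1 / \<mu>) *\<^sub>R (t *\<^sub>R 1 - z))" by simp
  then have "(\<epsilon> *\<^sub>R 1 + z) * ((1 / \<mu>) *\<^sub>R r) = 1"
    using r l0 by simp
  then show ?thesis ..
qed

section \<open>Idempotents, projections and right ideals\<close>

text \<open>With \<open>z = e - e\<^sup>*\<close>, the element \<open>g = 1 - z\<^sup>2 = (1 + z)(1 - z)\<close> is invertible and
  commutes with \<open>e\<close> and \<open>e\<^sup>*\<close>, because \<open>eg = ee\<^sup>*e = ge\<close>.  So \<open>ee\<^sup>*\<close> becomes a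
  projection when multiplied by \<open>g\<^sup>-\<^sup>1\<close>.\<close>

lemma projection_of_idempotent:
  fixes e :: "'a::unital_cstar_algebra"
  assumes idem: "e * e = e"
  shows "\<exists>p. projection p \<and> p * e = e \<and> e * p = p"
proof -
  define s where "s = star e"
  define z where "z = e - s"
  define g where "g = (1 + z) * (1 - z)"
  have ss: "s * s = s" using idem by (metis s_def star_mult)
  have st: "star s = e" "star e = s" by (simp_all add: s_def star_star)
  have skew: "star z = - z" "star (- z) = - (- z)" by (simp_all add: z_def st star_diff star_minus)
  obtain r where r: "(1 + z) * r = 1" using right_inverse_skew[OF skew(1), of 1] by auto
  obtain r' where r': "(1 - z) * r' = 1" using right_inverse_skew[OF skew(2), of 1] by auto
  define u where "u = r' * r"
  have gu: "g * u = 1" unfolding g_def u_def using r r' by (metis mult.assoc mult_1_left)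
  have sg: "star g = g"
    unfolding g_def by (simp add: star_mult star_add star_diff star_one skew algebra_simps)
  have "star u * g = 1" using gu sg by (metis star_mult star_one)
  then have u': "star u = u" and ug: "u * g = 1" using gu by (metis mult.assoc mult_1_left mult_1_right)+
  have gex: "g = 1 + e * s + s * e - e - s"
    unfolding g_def z_def by (simp add: algebra_simps idem ss)
  have ee: "e * (e * x) = e * x" for x using idem by (metis mult.assoc)
  have s2: "s * (s * x) = s * x" for x using ss by (metis mult.assoc)
  have eg: "e * g = e * (s * e)" and ge: "g * e = e * (s * e)"
    and sgm: "s * g = s * (e * s)" and gs: "g * s = s * (e * s)"
    unfolding gex by (simp_all add: algebra_simps idem ss ee s2)
  have comm: "x * u = u * x" if "x * g = g * x" for x
  proof -
    have "x * u = (u * g) * (x * u)" by (simp add: ug)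
    also have "\<dots> = u * (g * x) * u" by (simp only: mult.assoc)
    also have "\<dots> = u * (x * g) * u" by (simp only: that)
    also have "\<dots> = u * x" by (simp only: mult.assoc gu mult_1_right)
    finally show ?thesis .
  qed
  have eu: "e * u = u * e" using comm eg ge by simp
  have su: "s * u = u * s" using comm sgm gs by simp
  define p where "p = e * (s * u)"
  have p1: "star p = p" unfolding p_def by (simp add: star_mult u' st) (simp add: mult.assoc su flip: eu)
  have p2: "e * p = p" unfolding p_def by (simp add: ee)
  have "p * e = e * (s * e) * u" unfolding p_def by (simp add: mult.assoc eu)
  also have "\<dots> = e" by (simp add: mult.assoc gu flip: eg)
  finally have p3: "p * e = e" .
  have "p * p = p" using p3 unfolding p_def by (metis mult.assoc)
  then show ?thesis using p1 p2 p3 by (auto simp: projection_def)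
qed

lemma mem_range_idempotent:
  fixes e :: "'a::unital_cstar_algebra"
  assumes "e * e = e"
  shows "x \<in> range (left_mult e) \<longleftrightarrow> e * x = x"
  using assms by (auto simp: left_mult_def image_iff) (metis mult.assoc, metis)

lemma range_left_mult_subset:
  fixes e p :: "'a::unital_cstar_algebra"
  assumes "e = p * c"
  shows "range (left_mult e) \<subseteq> range (left_mult p)"
  by (auto simp: left_mult_def assms mult.assoc)

lemma range_left_mult_eqI:
  fixes e p :: "'a::unital_cstar_algebra"
  assumes "p * e = e" "e * p = p"
  shows "range (left_mult e) = range (left_mult p)"
  using range_left_mult_subset[of e p e] range_left_mult_subset[of p e p] assms by auto

lemma closed_submodule_range_idempotent:
  fixes e :: "'a::unital_cstar_algebra"
  assumes "e * e = e"
  shows "closed_submodule (range (left_mult e))"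
proof -
  have "range (left_mult e) = {x. e * x = x}" using mem_range_idempotent[OF assms] by blast
  moreover have "closed {x. e * x = x}" by (intro closed_Collect_eq continuous_intros)
  ultimately show ?thesis
    by (auto simp: closed_submodule_def distrib_left simp flip: mult.assoc)
qed

lemma idempotent_complement:
  fixes e :: "'a::unital_cstar_algebra"
  shows "e * e = e \<Longrightarrow> (1 - e) * (1 - e) = 1 - e"
  by (simp add: algebra_simps)

lemma projection_complement:
  fixes p :: "'a::unital_cstar_algebra"
  shows "projection p \<Longrightarrow> projection (1 - p)"
  by (simp add: projection_def idempotent_complement star_diff star_one)

lemma direct_decomposition_of_idempotent:
  fixes e :: "'a::unital_cstar_algebra"
  assumes e: "e * e = e"
  shows "direct_decomposition (range (left_mult e)) (range (left_mult (1 - e)))"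
proof -
  note f = idempotent_complement[OF e]
  have "\<exists>x y. w = x + y \<and> x \<in> range (left_mult e) \<and> y \<in> range (left_mult (1 - e))" for w
    by (rule exI[of _ "e * w"], rule exI[of _ "(1 - e) * w"]) (auto simp: left_mult_def algebra_simps)
  moreover have "range (left_mult e) \<inter> range (left_mult (1 - e)) = {0}"
    unfolding set_eq_iff Int_iff mem_range_idempotent[OF e] mem_range_idempotent[OF f]
    by (auto simp: left_diff_distrib)
  ultimately show ?thesis
    unfolding direct_decomposition_def
    using closed_submodule_range_idempotent[OF e] closed_submodule_range_idempotent[OF f]
    by blast
qed

text \<open>The components of 1 are the idempotents: for \<open>x \<in> M\<close> the difference
  \<open>x - ex = fx\<close> lies in \<open>M \<inter> N\<close>.\<close>

lemma direct_decomposition_idempotent: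
  fixes M N :: "'a::unital_cstar_algebra set"
  assumes "direct_decomposition M N"
  shows "\<exists>f. f * f = f \<and> M = range (left_mult (1 - f)) \<and> N = range (left_mult f)"
proof -
  have M: "closed_submodule M" and N: "closed_submodule N" and int: "M \<inter> N = {0}"
    and sum: "{x + y | x y. x \<in> M \<and> y \<in> N} = UNIV"
    using assms by (auto simp: direct_decomposition_def)
  have diff: "x - y \<in> K" if "closed_submodule K" "x \<in> K" "y \<in> K" for x y and K :: "'a set"
  proof -
    have "y * (- 1) \<in> K" using that unfolding closed_submodule_def by blast
    then have "x + y * (- 1) \<in> K" using that unfolding closed_submodule_def by blast
    then show ?thesis by simp
  qed
  have right: "x * c \<in> K" if "closed_submodule K" "x \<in> K" for x c and K :: "'a set"
    using that unfolding closed_submodule_def by blast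
  obtain e f where e: "e \<in> M" and f: "f \<in> N" and ef: "1 = e + f" using sum by blast
  have split: "x = e * x + f * x" for x using ef by (metis distrib_right mult_1_left)
  have Mx: "e * x = x" if "x \<in> M" for x
  proof -
    have "x - e * x \<in> M" using diff right M e that by blast
    moreover have "x - e * x = f * x" using split[of x] by (simp add: diff_eq_eq add.commute)
    ultimately have "x - e * x \<in> M \<inter> N" using right[OF N f] by simp
    then show ?thesis using int by simp
  qed
  have Nx: "f * x = x" if "x \<in> N" for x
  proof -
    have "x - f * x \<in> N" using diff right N f that by blast
    moreover have "x - f * x = e * x" using split[of x] by (simp add: diff_eq_eq)
    ultimately have "x - f * x \<in> M \<inter> N" using right[OF M e] by simp
    then show ?thesis using int by simp
  qed
  have "e = 1 - f" by (simp add: ef)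
  moreover have "M = range (left_mult e)"
    using Mx right[OF M e] by (auto simp: left_mult_def image_iff) metis
  moreover have "N = range (left_mult f)"
    using Nx right[OF N f] by (auto simp: left_mult_def image_iff) metis
  ultimately show ?thesis using Nx[OF f] by blast
qed

lemma orth_compl_range_projection:
  fixes p :: "'a::unital_cstar_algebra"
  assumes "projection p"
  shows "orth_compl (range (left_mult p)) = range (left_mult (1 - p))"
proof -
  have p: "star p = p" "p * p = p" using assms by (auto simp: projection_def)
  have "(\<forall>c. star (p * c) * x = 0) \<longleftrightarrow> p * x = 0" for x
  proof
    assume "\<forall>c. star (p * c) * x = 0"
    from this[rule_format, of 1] show "p * x = 0" by (simp add: p)
  qed (simp add: star_mult p mult.assoc)
  then show ?thesis
    unfolding set_eq_iff mem_range_idempotent[OF idempotent_complement[OF p(2)]]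
    by (auto simp: orth_compl_def left_mult_def algebra_simps)
qed

lemma orth_proj_range_projection:
  fixes p :: "'a::unital_cstar_algebra"
  assumes pr: "projection p"
  shows "orth_proj (range (left_mult p)) = left_mult p"
proof
  fix x
  have p: "p * p = p" using pr by (auto simp: projection_def)
  show "orth_proj (range (left_mult p)) x = left_mult p x"
    unfolding orth_proj_def orth_compl_range_projection[OF pr]
      mem_range_idempotent[OF p] mem_range_idempotent[OF idempotent_complement[OF p]]
    by (rule the_equality) (auto simp: left_mult_def algebra_simps p simp flip: mult.assoc)
qed

lemma left_mult_mem_image_iff:
  fixes a :: "'a::unital_cstar_algebra"
  shows "left_mult a \<in> left_mult ` S \<longleftrightarrow> a \<in> S"
  by (auto simp: left_mult_def dest: fun_cong[where x = 1])

section \<open>Closed range and von Neumann regularity\<close>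

lemma closed_cover_interior:
  fixes E :: "'a::{real_normed_vector, complete_space} set" and C :: "nat \<Rightarrow> 'a set"
  assumes "closed E" "E \<noteq> {}" "\<And>n. closed (C n)" "E \<subseteq> (\<Union>n. C n)"
  shows "\<exists>n e r. e \<in> E \<and> r > 0 \<and> ball e r \<inter> E \<subseteq> C n"
proof -
  let ?X = "top_of_set E"
  have "completely_metrizable_space ?X"
    using assms(1) completely_metrizable_space_closedin completely_metrizable_space_euclidean
    by (metis closed_closedin)
  moreover have "closedin ?X (E \<inter> C n)" for n
    using assms(3) by (simp add: closedin_closed_Int)
  ultimately have "?X interior_of (\<Union>n. E \<inter> C n) = {}" if "\<And>n. ?X interior_of (E \<inter> C n) = {}"
    using that by (intro Baire_category_alt) auto
  moreover have "(\<Union>n. E \<inter> C n) = topspace ?X" using assms(4) by auto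
  then have "?X interior_of (\<Union>n. E \<inter> C n) = E" by (simp only: interior_of_topspace) simp
  ultimately obtain n e where "e \<in> ?X interior_of (E \<inter> C n)" using assms(2) by blast
  then obtain T where T: "openin ?X T" "e \<in> T" "T \<subseteq> E \<inter> C n"
    by (auto simp: interior_of_def)
  then obtain r where "r > 0" "ball e r \<inter> E \<subseteq> T" "e \<in> E"
    by (metis openin_contains_ball openin_imp_subset subsetD)
  then show ?thesis using T by blast
qed

text \<open>A uniform boundedness argument.  Let \<open>Y\<close> consist of the \<open>y \<in> aA\<close> with
  \<open>\<parallel>a\<^sup>*y\<parallel> \<le> 1\<close>.  The operators \<open>x \<mapsto> y\<^sup>*x\<close>, \<open>y \<in> Y\<close>, are pointwise bounded on
  \<open>aA\<close>, as \<open>\<parallel>y\<^sup>*ac\<parallel> \<le> \<parallel>c\<parallel>\<close>.  Since \<open>aA\<close> is complete they are bounded in norm, and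
  their norms dominate \<open>\<parallel>y\<parallel>\<close> because \<open>\<parallel>y\<^sup>*y\<parallel> = \<parallel>y\<parallel>\<^sup>2\<close>.\<close>

lemma star_bounded_below_on_closed_range:
  fixes a :: "'a::unital_cstar_algebra"
  assumes cl: "closed (range (left_mult a))"
  shows "\<exists>K>0. \<forall>y\<in>range (left_mult a). norm y \<le> K * norm (star a * y)"
proof -
  let ?E = "range (left_mult a)"
  define Y where "Y = {y \<in> ?E. norm (star a * y) \<le> 1}"
  define C where "C n = {x. \<forall>y\<in>Y. norm (star y * x) \<le> real n}" for n
  have scal: "t *\<^sub>R x \<in> ?E" if "x \<in> ?E" for t x
    using that by (auto simp: left_mult_def image_iff) (metis mult_scaleR_right)
  have add: "x + y \<in> ?E" if "x \<in> ?E" "y \<in> ?E" for x y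
    using that by (auto simp: left_mult_def image_iff) (metis distrib_left)
  have "closed (C n)" for n
  proof -
    have "C n = (\<Inter>y\<in>Y. {x. norm (star y * x) \<le> real n})" by (auto simp: C_def)
    moreover have "closed {x. norm (star y * x) \<le> real n}" for y :: 'a
      by (intro closed_Collect_le continuous_intros)
    ultimately show ?thesis by auto
  qed
  moreover have "?E \<subseteq> (\<Union>n. C n)"
  proof
    fix x assume "x \<in> ?E"
    then obtain c where c: "x = a * c" by (auto simp: left_mult_def)
    obtain n where n: "norm c \<le> real n" using real_arch_simple by blast
    have "norm (star y * x) \<le> real n" if "y \<in> Y" for y
    proof -
      have "star y * x = star (star a * y) * c" by (simp add: c star_mult star_star mult.assoc)
      then have "norm (star y * x) \<le> norm (star a * y) * norm c"
        by (metis norm_mult_ineq norm_star)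
      also have "\<dots> \<le> norm c" using that by (simp add: Y_def mult_left_le_one_le)
      finally show ?thesis using n by simp
    qed
    then show "x \<in> (\<Union>n. C n)" by (auto simp: C_def)
  qed
  ultimately obtain n e r where e: "e \<in> ?E" and r: "r > 0" and ball: "ball e r \<inter> ?E \<subseteq> C n"
    using closed_cover_interior[OF cl] by blast
  define K where "K = 4 * real n / r + 1"
  have K0: "K > 0" using r by (simp add: K_def add_nonneg_pos)
  have Yb: "norm y \<le> K" if y: "y \<in> Y" for y
  proof (cases "y = 0")
    case False
    define t where "t = r / (2 * norm y)"
    have t: "t > 0" using False r by (simp add: t_def)
    have yE: "y \<in> ?E" using y by (simp add: Y_def)
    have "e + t *\<^sub>R y \<in> ball e r" using False r by (simp add: dist_norm t_def)
    then have 1: "norm (star y * (e + t *\<^sub>R y)) \<le> n"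
      using ball y add[OF e scal[OF yE]] by (auto simp: C_def)
    have "e \<in> C n" using ball e r by (meson IntI centre_in_ball subsetD)
    then have 2: "norm (star y * e) \<le> n" using y by (simp add: C_def)
    have "t * (norm y)\<^sup>2 = norm (t *\<^sub>R (star y * y))" using t by (simp add: cstar_identity)
    also have "t *\<^sub>R (star y * y) = star y * (e + t *\<^sub>R y) - star y * e"
      by (simp add: distrib_left)
    also have "norm \<dots> \<le> 2 * n"
      using 1 2 norm_triangle_ineq4[of "star y * (e + t *\<^sub>R y)" "star y * e"] by linarith
    finally have "norm y * r \<le> 4 * n" using False
      by (simp add: t_def power2_eq_square field_simps)
    then have "norm y \<le> 4 * real n / r" using r by (simp add: field_simps)
    then show ?thesis by (simp add: K_def)
  qed (use K0 in simp)
  have "norm y \<le> K * norm (star a * y)" if y: "y \<in> ?E" for y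
  proof (cases "star a * y = 0")
    case True
    \<comment> \<open>All multiples of \<open>y\<close> lie in the bounded set \<open>Y\<close>.\<close>
    have "(((K + 1) / norm y) *\<^sub>R y) \<in> Y" using scal[OF y] by (simp add: Y_def True)
    from Yb[OF this] show ?thesis using K0 by (cases "y = 0") auto
  next
    case False
    have "(1 / norm (star a * y)) *\<^sub>R y \<in> Y" using scal[OF y] False by (simp add: Y_def)
    from Yb[OF this] show ?thesis using False by (simp add: field_simps)
  qed
  then show ?thesis using K0 by blast
qed

text \<open>By the C*-identity, \<open>\<parallel>a\<^sup>*y\<parallel>\<^sup>2 = \<parallel>y\<^sup>*(aa\<^sup>*y)\<parallel> \<le> \<parallel>y\<parallel> \<parallel>aa\<^sup>*y\<parallel>\<close>.\<close>

lemma mult_star_bounded_below: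
  fixes a y :: "'a::unital_cstar_algebra"
  assumes "K > 0" and K: "norm y \<le> K * norm (star a * y)"
  shows "norm y \<le> K\<^sup>2 * norm (a * (star a * y))"
proof (cases "y = 0")
  case False
  have "(norm y)\<^sup>2 \<le> K\<^sup>2 * (norm (star a * y))\<^sup>2"
    using K by (metis norm_ge_zero power_mono power_mult_distrib)
  also have "(norm (star a * y))\<^sup>2 = norm (star y * (a * (star a * y)))"
    by (simp add: star_mult star_star mult.assoc flip: cstar_identity)
  also have "\<dots> \<le> norm y * norm (a * (star a * y))"
    by (metis norm_mult_ineq norm_star)
  finally have "norm y * norm y \<le> norm y * (K\<^sup>2 * norm (a * (star a * y)))"
    by (simp add: power2_eq_square[of "norm y"] mult_left_mono mult.left_commute)
  then show ?thesis using False by simp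
qed simp

text \<open>For \<open>h = aa\<^sup>*\<close> and \<open>\<epsilon>\<^sub>n \<rightarrow> 0\<close> the solutions of \<open>(\<epsilon>\<^sub>n + ih) x\<^sub>n = ia\<close> lie in
  \<open>aA\<close>, since \<open>\<epsilon>\<^sub>n x\<^sub>n = i(a - hx\<^sub>n)\<close>.  Boundedness of \<open>h\<close> from below on \<open>aA\<close> makes them
  bounded, hence \<open>hx\<^sub>n \<rightarrow> a\<close>, and then Cauchy; their limit \<open>c\<close> satisfies \<open>hc = a\<close>.\<close>

lemma regular_of_closed_range:
  fixes a :: "'a::unital_cstar_algebra"
  assumes cl: "closed (range (left_mult a))"
  shows "\<exists>b. a * b * a = a"
proof -
  let ?E = "range (left_mult a)"
  define h where "h = a * star a"
  obtain K where K: "K > 0" and Ky: "\<And>y. y \<in> ?E \<Longrightarrow> norm y \<le> K * norm (star a * y)"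
    using star_bounded_below_on_closed_range[OF cl] by blast
  define L where "L = K\<^sup>2"
  have L: "L > 0" using K by (simp add: L_def)
  have lower: "norm y \<le> L * norm (h * y)" if "y \<in> ?E" for y
    using mult_star_bounded_below[OF K Ky[OF that]] by (simp add: L_def h_def mult.assoc)
  have diffE: "x - y \<in> ?E" if "x \<in> ?E" "y \<in> ?E" for x y
    using that by (auto simp: left_mult_def image_iff) (metis right_diff_distrib)
  have skew: "star (\<i> *\<^sub>C h) = - (\<i> *\<^sub>C h)"
  proof -
    have "star (\<i> *\<^sub>C h) = (- \<i>) *\<^sub>C h" by (simp add: star_scaleC h_def star_mult star_star)
    also have "\<dots> = (-1) *\<^sub>C (\<i> *\<^sub>C h)" by (simp add: scaleC_scaleC)
    also have "\<dots> = - (\<i> *\<^sub>C h)" using scaleC_of_real[of "-1" "\<i> *\<^sub>C h"] by simp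
    finally show ?thesis .
  qed
  have i2: "\<i> *\<^sub>C (\<i> *\<^sub>C x) = - x" for x :: 'a
    using scaleC_of_real[of "-1" x] by (simp add: scaleC_scaleC)
  have "\<exists>x\<in>?E. a - h * x = - (\<epsilon> *\<^sub>R (\<i> *\<^sub>C x))" if eps: "\<epsilon> > 0" for \<epsilon>
  proof -
    obtain r where r: "(\<epsilon> *\<^sub>R 1 + \<i> *\<^sub>C h) * r = 1"
      using right_inverse_skew[OF skew eps] by blast
    define x where "x = r * (\<i> *\<^sub>C a)"
    have "(\<epsilon> *\<^sub>R 1 + \<i> *\<^sub>C h) * x = \<i> *\<^sub>C a"
      using r by (metis x_def mult.assoc mult_1_left)
    then have eq: "\<epsilon> *\<^sub>R x + \<i> *\<^sub>C (h * x) = \<i> *\<^sub>C a"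
      by (simp add: distrib_right mult_scaleC_left)
    have "\<i> *\<^sub>C (\<epsilon> *\<^sub>R x) + \<i> *\<^sub>C (\<i> *\<^sub>C (h * x)) = \<i> *\<^sub>C (\<i> *\<^sub>C a)"
      using eq by (metis scaleC_add_right)
    then have "\<i> *\<^sub>C (\<epsilon> *\<^sub>R x) - h * x = - a" by (simp add: i2)
    moreover have "\<i> *\<^sub>C (\<epsilon> *\<^sub>R x) = \<epsilon> *\<^sub>R (\<i> *\<^sub>C x)"
      by (simp add: scaleC_scaleC mult.commute flip: scaleC_of_real)
    ultimately have res: "a - h * x = - (\<epsilon> *\<^sub>R (\<i> *\<^sub>C x))"
      by (simp add: algebra_simps)
    have "a * (\<i> *\<^sub>C 1 - star a * (\<i> *\<^sub>C x)) = \<i> *\<^sub>C a - \<i> *\<^sub>C (h * x)"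
      by (simp add: h_def right_diff_distrib mult_scaleC_right mult.assoc)
    also have "\<dots> = \<epsilon> *\<^sub>R x" using eq by (simp add: algebra_simps)
    finally have "x = a * ((1 / \<epsilon>) *\<^sub>R (\<i> *\<^sub>C 1 - star a * (\<i> *\<^sub>C x)))" using eps by simp
    then have "x \<in> ?E" unfolding left_mult_def by (rule range_eqI)
    then show ?thesis using res by blast
  qed
  then have "\<forall>n. \<exists>x\<in>?E. a - h * x = - (inverse (real (Suc n)) *\<^sub>R (\<i> *\<^sub>C x))" by simp
  then obtain x where xE: "\<And>n. x n \<in> ?E"
    and xeq: "\<And>n. a - h * x n = - (inverse (real (Suc n)) *\<^sub>R (\<i> *\<^sub>C x n))" by metis
  have err: "norm (a - h * x n) = inverse (real (Suc n)) * norm (x n)" for n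
    by (simp add: xeq norm_scaleC)
  \<comment> \<open>The bound on \<open>x n\<close> needs \<open>L / (n + 1) \<le> 1/2\<close>, so it holds from some index on.\<close>
  obtain n0 where n0: "2 * L \<le> real n0" using real_arch_simple by blast
  have bnd: "norm (x n) \<le> 2 * L * norm a" if "n \<ge> n0" for n
  proof -
    have "norm (h * x n) \<le> norm a + norm (a - h * x n)"
      using norm_triangle_ineq4[of a "a - h * x n"] by simp
    then have "norm (x n) \<le> L * (norm a + inverse (real (Suc n)) * norm (x n))"
      using lower[OF xE[of n]] L unfolding err by (smt (verit) mult_left_mono)
    moreover have "L * inverse (real (Suc n)) \<le> 1 / 2"
      using n0 that L by (simp add: field_simps)
    then have "L * inverse (real (Suc n)) * norm (x n) \<le> 1 / 2 * norm (x n)"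
      by (intro mult_right_mono) auto
    ultimately show ?thesis by (simp add: algebra_simps)
  qed
  have hx: "(\<lambda>n. h * x n) \<longlonglongrightarrow> a"
  proof -
    have "(\<lambda>n. inverse (real (Suc n)) * (2 * L * norm a)) \<longlonglongrightarrow> 0"
      using tendsto_mult_left_zero[OF LIMSEQ_inverse_real_of_nat] .
    moreover have "\<forall>\<^sub>F n in sequentially.
        norm (a - h * x n) \<le> inverse (real (Suc n)) * (2 * L * norm a)"
      unfolding err using bnd
      by (intro eventually_sequentiallyI[of n0] mult_left_mono) auto
    ultimately have "(\<lambda>n. a - h * x n) \<longlonglongrightarrow> 0" by (rule Lim_null_comparison[rotated])
    from tendsto_diff[OF tendsto_const[of a] this] show ?thesis by simp
  qed
  have "Cauchy x"
  proof (rule metric_CauchyI)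
    fix d :: real assume d: "d > 0"
    have "Cauchy (\<lambda>n. h * x n)" using hx by (simp add: LIMSEQ_imp_Cauchy)
    then obtain N where N: "\<And>m n. m \<ge> N \<Longrightarrow> n \<ge> N \<Longrightarrow> dist (h * x m) (h * x n) < d / L"
      using metric_CauchyD[of _ "d / L"] d L by fastforce
    have "dist (x m) (x n) < d" if "m \<ge> N" "n \<ge> N" for m n
    proof -
      have "norm (x m - x n) \<le> L * norm (h * x m - h * x n)"
        using lower[OF diffE[OF xE xE]] by (simp add: right_diff_distrib)
      also have "\<dots> < d" using N[OF that] L by (simp add: dist_norm field_simps)
      finally show ?thesis by (simp add: dist_norm)
    qed
    then show "\<exists>M. \<forall>m\<ge>M. \<forall>n\<ge>M. dist (x m) (x n) < d" by blast
  qed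
  then obtain c where "x \<longlonglongrightarrow> c" using Cauchy_convergent convergent_def by blast
  then have "(\<lambda>n. h * x n) \<longlonglongrightarrow> h * c" by (intro tendsto_intros)
  then have hc: "h * c = a" using hx LIMSEQ_unique by blast
  have "a * star c * a = a * star c * (h * c)" by (simp add: hc)
  also have "\<dots> = a * star (h * c) * c"
    by (simp add: h_def star_mult star_star mult.assoc)
  also have "\<dots> = a" unfolding hc using hc by (simp add: h_def)
  finally show ?thesis ..
qed

section \<open>Upper and lower semi-Fredholm operators\<close>

lemma module_operator_eq_left_mult:
  fixes F :: "'a::unital_cstar_algebra \<Rightarrow> 'a"
  assumes "F \<in> module_operators"
  shows "F = left_mult (F 1)"
proof
  fix x
  have "F (1 * x) = F 1 * x" using assms unfolding module_operators_def by blast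
  then show "F x = left_mult (F 1) x" by (simp add: left_mult_def)
qed

lemma left_mult_module_operator: "left_mult a \<in> module_operators"
  by (simp add: module_operators_def left_mult_def mult.assoc bounded_linear_mult_right)

text \<open>With \<open>aba = a\<close>, the kernel is the range of \<open>1 - ba\<close> and the image that of \<open>ab\<close>.\<close>

lemma kernel_range_projections:
  fixes a b :: "'a::unital_cstar_algebra"
  assumes reg: "a * b * a = a"
  shows "\<exists>p. projection p \<and> {x. a * x = 0} = range (left_mult p)"
    and "\<exists>q. projection q \<and> range (left_mult a) = range (left_mult q)"
proof -
  define k where "k = 1 - b * a"
  have ba: "b * a * (b * a) = b * a" and ab: "a * b * (a * b) = a * b"
    using reg by (metis mult.assoc)+
  have kk: "k * k = k" unfolding k_def by (rule idempotent_complement[OF ba])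
  have "a * x = 0 \<longleftrightarrow> k * x = x" for x
  proof
    assume "k * x = x"
    then have "b * a * x = 0" by (simp add: k_def left_diff_distrib)
    then show "a * x = 0" using reg by (metis mult.assoc mult_zero_right)
  qed (simp add: k_def left_diff_distrib mult.assoc)
  then have ker: "{x. a * x = 0} = range (left_mult k)"
    unfolding set_eq_iff mem_range_idempotent[OF kk] by simp
  obtain p where "projection p" "p * k = k" "k * p = p"
    using projection_of_idempotent[OF kk] by blast
  then show "\<exists>p. projection p \<and> {x. a * x = 0} = range (left_mult p)"
    using range_left_mult_eqI[of p k] ker by auto
  have ran: "range (left_mult a) = range (left_mult (a * b))"
    using range_left_mult_subset[of a "a * b" a] range_left_mult_subset[of "a * b" a b] reg
    by auto
  obtain q where "projection q" "q * (a * b) = a * b" "a * b * q = q"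
    using projection_of_idempotent[OF ab] by blast
  then show "\<exists>q. projection q \<and> range (left_mult a) = range (left_mult q)"
    using range_left_mult_eqI[of q "a * b"] ran by auto
qed

lemma kernel_range_diagonalize:
  fixes a b p q :: "'a::unital_cstar_algebra"
  assumes reg: "a * b * a = a"
    and p: "projection p" and ker: "{x. a * x = 0} = range (left_mult p)"
    and q: "projection q" and ran: "range (left_mult a) = range (left_mult q)"
  shows "diagonalizing_decomposition (left_mult a)
    (range (left_mult (1 - p))) (range (left_mult p))
    (range (left_mult q)) (range (left_mult (1 - q)))"
proof -
  let ?M = "range (left_mult (1 - p))"
  have pp: "p * p = p" and qq: "q * q = q" using p q by (auto simp: projection_def)
  note memM = mem_range_idempotent[OF idempotent_complement[OF pp]]
  have kx: "a * x = 0 \<longleftrightarrow> p * x = x" for x using ker mem_range_idempotent[OF pp] by blast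
  have ap: "a * (p * x) = 0" for x
  proof (rule iffD2[OF kx])
    show "p * (p * x) = p * x" by (simp add: pp flip: mult.assoc)
  qed
  \<comment> \<open>On \<open>(ker F)\<^sup>\<bottom>\<close> the operator is inverted by \<open>(1 - p) b\<close>.\<close>
  have inv: "(1 - p) * b * (a * x) = x" if "x \<in> ?M" for x
  proof -
    have px: "p * x = 0" using that by (simp add: memM left_diff_distrib)
    have "a * (b * (a * x) - x) = 0" using reg by (simp add: right_diff_distrib flip: mult.assoc)
    then have "p * (b * (a * x) - x) = b * (a * x) - x" by (rule iffD1[OF kx])
    then have "p * (b * (a * x)) = b * (a * x) - x" by (simp add: right_diff_distrib px)
    then show ?thesis by (simp add: left_diff_distrib mult.assoc)
  qed
  have inj: "inj_on (left_mult a) ?M"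
    by (rule inj_on_inverseI[of _ "\<lambda>y. (1 - p) * b * y"]) (simp add: left_mult_def inv)
  have im: "left_mult a ` ?M = range (left_mult a)"
  proof -
    have "left_mult a x = left_mult a (left_mult (1 - p) x)" for x
      by (simp add: left_mult_def left_diff_distrib right_diff_distrib ap)
    then show ?thesis by blast
  qed
  have bound: "norm (inv_into ?M (left_mult a) y) \<le> norm ((1 - p) * b) * norm y"
    if y: "y \<in> range (left_mult q)" for y
  proof -
    obtain x where x: "x \<in> ?M" "y = left_mult a x" using y im ran by blast
    have "norm x \<le> norm ((1 - p) * b) * norm (a * x)"
      using inv[OF x(1)] norm_mult_ineq by metis
    then show ?thesis using x inj by (simp add: left_mult_def)
  qed
  have "left_mult a ` range (left_mult p) \<subseteq> range (left_mult (1 - q))"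
  proof -
    have "0 = left_mult (1 - q) 0" by (simp add: left_mult_def)
    then have "0 \<in> range (left_mult (1 - q))" by (rule range_eqI)
    then show ?thesis by (auto simp: left_mult_def ap)
  qed
  moreover have "direct_decomposition ?M (range (left_mult p))"
    using direct_decomposition_of_idempotent[OF idempotent_complement[OF pp]] by simp
  moreover have "restricts_to_iso (left_mult a) ?M (range (left_mult q))"
    unfolding restricts_to_iso_def bij_betw_def
    by (intro conjI exI[of _ "norm ((1 - p) * b)"] ballI bound inj left_mult_module_operator)
      (simp_all only: im ran)
  ultimately show ?thesis
    unfolding diagonalizing_decomposition_def
    using direct_decomposition_of_idempotent[OF qq] by (simp add: im ran)
qed

text \<open>Being complementable, \<open>N\<close> is the range of a projection, which is the only candidate for
  the element representing \<open>orth_proj N\<close>.\<close>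

lemma summand_projection_mem:
  fixes M N :: "'a::unital_cstar_algebra set"
  assumes dd: "direct_decomposition M N" and mem: "orth_proj N \<in> left_mult ` S"
  shows "\<exists>p f. p \<in> S \<and> f * f = f \<and> p * f = f
    \<and> M = range (left_mult (1 - f)) \<and> N = range (left_mult f)"
proof -
  obtain f where f: "f * f = f" "M = range (left_mult (1 - f))" "N = range (left_mult f)"
    using direct_decomposition_idempotent[OF dd] by blast
  obtain p where p: "projection p" "p * f = f" "f * p = p"
    using projection_of_idempotent[OF f(1)] by blast
  have "N = range (left_mult p)" using range_left_mult_eqI[OF p(2,3)] f(3) by simp
  then have "p \<in> S"
    using mem orth_proj_range_projection[OF p(1)] by (simp add: left_mult_mem_image_iff)
  then show ?thesis using f p by blast
qed

text \<open>If \<open>x = m + n\<close> is killed by \<open>T\<close>, then \<open>Tm = T(-n)\<close> lies in \<open>M\<^sub>2 \<inter> N\<^sub>2 = {0}\<close>, and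
  injectivity on \<open>M\<^sub>1\<close> leaves \<open>x = n\<close>.\<close>

lemma kernel_subset_summand:
  assumes d: "diagonalizing_decomposition T M1 N1 M2 N2" and T: "T x = 0"
  shows "x \<in> N1"
proof -
  have dd: "direct_decomposition M1 N1" "direct_decomposition M2 N2"
    and im: "T ` M1 \<subseteq> M2" "T ` N1 \<subseteq> N2" and inj: "inj_on T M1" and op: "T \<in> module_operators"
    using d by (auto simp: diagonalizing_decomposition_def restricts_to_iso_def bij_betw_def)
  have lin: "linear T" using op by (simp add: module_operators_def bounded_linear.linear)
  obtain m n where mn: "m \<in> M1" "n \<in> N1" "x = m + n"
    using dd(1) unfolding direct_decomposition_def by blast
  have M1: "0 \<in> M1" using dd(1) by (simp add: direct_decomposition_def closed_submodule_def)
  have "n * (- 1) \<in> N1"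
    using dd(1) mn(2) unfolding direct_decomposition_def closed_submodule_def by blast
  then have "T (- n) \<in> N2" using im(2) by auto
  moreover have "T m = T (- n)"
    using T by (simp add: mn(3) linear_add[OF lin] linear_neg[OF lin] eq_neg_iff_add_eq_0)
  ultimately have "T m \<in> M2 \<inter> N2" using im(1) mn(1) by auto
  then have "T m = T 0" using dd(2) linear_0[OF lin] by (auto simp: direct_decomposition_def)
  then have "m = 0" using inj mn(1) M1 by (auto dest: inj_onD)
  then show ?thesis using mn by simp
qed

theorem lemma3p3:
  fixes \<F> :: "'a::unital_cstar_algebra set"
    and F :: "'a \<Rightarrow> 'a"
  assumes "finite_type_ideal \<F>"
    and "F \<in> module_operators"
    and "closed (range F)"
  shows "(F \<in> MKPhi_plus \<F> \<longleftrightarrow> orth_proj {x. F x = 0} \<in> left_mult ` \<F>) \<and>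
         (F \<in> MKPhi_minus \<F> \<longleftrightarrow> orth_proj (orth_compl (range F)) \<in> left_mult ` \<F>)"
proof -
  have ideal: "x * f \<in> \<F>" "f * x \<in> \<F>" if "f \<in> \<F>" for x f
    using assms(1) that by (auto simp: finite_type_ideal_def)
  define a where "a = F 1"
  have F: "F = left_mult a" using module_operator_eq_left_mult[OF assms(2)] by (simp add: a_def)
  obtain b where reg: "a * b * a = a"
    using regular_of_closed_range assms(3) unfolding F by blast
  obtain p where p: "projection p" and ker: "{x. a * x = 0} = range (left_mult p)"
    using kernel_range_projections(1)[OF reg] by blast
  obtain q where q: "projection q" and ran: "range (left_mult a) = range (left_mult q)"
    using kernel_range_projections(2)[OF reg] by blast
  have pp: "p * p = p" and qq: "q * q = q" using p q by (auto simp: projection_def)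
  have "{x. F x = 0} = range (left_mult p)" unfolding ker[symmetric] by (simp add: F left_mult_def)
  then have kerP: "orth_proj {x. F x = 0} = left_mult p"
    using orth_proj_range_projection[OF p] by simp
  have N2: "orth_proj (range (left_mult (1 - q))) = left_mult (1 - q)"
    by (rule orth_proj_range_projection[OF projection_complement[OF q]])
  have ranQ: "orth_proj (orth_compl (range F)) = left_mult (1 - q)"
    by (simp add: F ran orth_compl_range_projection[OF q] N2)
  note diag = kernel_range_diagonalize[OF reg p ker q ran, folded F]
  have "F \<in> MKPhi_plus \<F> \<longleftrightarrow> p \<in> \<F>"
  proof
    assume "F \<in> MKPhi_plus \<F>"
    then obtain M1 N1 M2 N2 where d: "diagonalizing_decomposition F M1 N1 M2 N2"
      and o: "orth_proj N1 \<in> left_mult ` \<F>" by (auto simp: MKPhi_plus_def)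
    have "direct_decomposition M1 N1" using d by (simp add: diagonalizing_decomposition_def)
    from summand_projection_mem[OF this o]
    obtain p1 f where f: "p1 \<in> \<F>" "f * f = f" "p1 * f = f" "N1 = range (left_mult f)" by blast
    have "a * p = 0" using ker mem_range_idempotent[OF pp] pp by blast
    then have "p \<in> N1" using kernel_subset_summand[OF d] by (simp add: F left_mult_def)
    then have "f * p = p" using f mem_range_idempotent by blast
    then have "p1 * p = p" using f(3) by (metis mult.assoc)
    then show "p \<in> \<F>" using ideal(2)[OF f(1), of p] by simp
  next
    assume "p \<in> \<F>"
    then have "orth_proj (range (left_mult p)) \<in> left_mult ` \<F>"
      by (simp add: orth_proj_range_projection[OF p])
    then show "F \<in> MKPhi_plus \<F>"
      unfolding MKPhi_plus_def using assms(2) diag by blast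
  qed
  moreover have "F \<in> MKPhi_minus \<F> \<longleftrightarrow> 1 - q \<in> \<F>"
  proof
    assume "F \<in> MKPhi_minus \<F>"
    then obtain M1 N1 M2 N2 where d: "diagonalizing_decomposition F M1 N1 M2 N2"
      and o: "orth_proj N2 \<in> left_mult ` \<F>" by (auto simp: MKPhi_minus_def)
    have "direct_decomposition M2 N2" using d by (simp add: diagonalizing_decomposition_def)
    from summand_projection_mem[OF this o]
    obtain p2 f where f: "p2 \<in> \<F>" "f * f = f" "p2 * f = f" "M2 = range (left_mult (1 - f))" by blast
    have "M2 \<subseteq> range F"
      using d unfolding diagonalizing_decomposition_def restricts_to_iso_def bij_betw_def by blast
    then have "M2 \<subseteq> range (left_mult q)" by (simp add: F ran)
    moreover have "1 - f \<in> M2"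
      using f mem_range_idempotent idempotent_complement by blast
    ultimately have "q * (1 - f) = 1 - f" using mem_range_idempotent[OF qq] by blast
    then have "(1 - q) * f = 1 - q" by (simp add: algebra_simps)
    moreover have "(1 - q) * f = (1 - q) * (p2 * f)" using f(3) by simp
    ultimately show "1 - q \<in> \<F>" using ideal(1)[OF ideal(2)[OF f(1), of f], of "1 - q"] by simp
  next
    assume "1 - q \<in> \<F>"
    then have "orth_proj (range (left_mult (1 - q))) \<in> left_mult ` \<F>" by (simp add: N2)
    then show "F \<in> MKPhi_minus \<F>"
      unfolding MKPhi_minus_def using assms(2) diag by blast
  qed
  ultimately show ?thesis by (simp add: kerP ranQ left_mult_mem_image_iff)
qed

end
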